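(* Let $G$ be a countable, discrete group, $n\geq 1$ an integer, and $f\in M_{n}(\mathbb{C}(G))$. Suppose that $\xi\in M_{n}(\ell^{2}(G))$ and $\lambda(f)\xi=\delta_{e}\otimes \mathrm{id}$. Then: (i) $\lambda(f)$ is injective as an operator $\ell^{2}(G)^{\oplus n}\to \ell^{2}(G)^{\oplus n}$; (ii) the operator $L_{\lambda(f)}\colon M_{n}(\ell^{2}(G))\to M_{n}(\ell^{2}(G))$ given by $L_{\lambda(f)}(\zeta)=\lambda(f)\zeta$ is injective; (iii) $\xi \lambda(f)=\delta_{e}\otimes \mathrm{id}$; (iv) $\xi\in M_{n}(\ell^{2}(G,\mathbb{R}))$.
   Context: $\mathbb{C}(G)$ is the complex group ring; for $a\in\mathbb{C}(G)$ write $a=\sum_{h\in G}\widehat{a}(h)h$. $\ell^2(G)$ denotes the complex-valued square-summable functions on $G$, and $\ell^2(G,\mathbb{R})$ the real-valued ones. For $f\in M_n(\mathbb{C}(G))$, the bounded operator $\lambda(f)$ on $\ell^2(G)^{\oplus n}$ is $$(\lambda(f)\eta)(l)(g)=\sum_{k=1}^n\sum_{h\in G}\widehat{f_{lk}}(h)\,\eta(k)(h^{-1}g),\qquad g\in G,\ 1\leq l\leq n.$$ For $\xi\in M_n(\ell^2(G))$, the elements $\lambda(f)\xi,\ \xi\lambda(f)\in M_n(\ell^2(G))$ are $$(\lambda(f)\xi)_{ij}(g)=\sum_{k=1}^n\sum_{h\in G}\widehat{f_{ik}}(h)\,\xi_{kj}(h^{-1}g),\qquad (\xi\lambda(f))_{ij}(g)=\sum_{k=1}^n\sum_{h\in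 G}\xi_{ik}(h)\,\widehat{f_{kj}}(h^{-1}g).$$ $\delta_e\otimes\mathrm{id}\in M_n(\ell^2(G))$ is the matrix whose $(i,j)$ entry is $\delta_e$ (the indicator function of the identity $e\in G$) if $i=j$, and $0$ otherwise.
   Formalization: Part (iv) is false for complex f (f = i·id gives ξ = −i·δ_e⊗id, which is not real); it is stated here under the additional hypothesis that f has real coefficients, f ∈ M_n(ℝ(G)). *)

theory Defs
  imports
    "HOL-Analysis.Analysis"
    "HOL-Algebra.Group"
    "HOL-Library.Poly_Mapping"
begin

text \<open>
  Group elements live in the carrier of a HOL-Algebra group \<open>G\<close> with elements of type \<open>'a\<close>.
  Functions on \<open>G\<close> are represented by functions on all of \<open>'a\<close> that vanish off the carrier, so
  that equality of functions on \<open>G\<close> is equality in HOL. The index set of the \<open>n \<times> n\<close> matrices is a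
  finite type \<open>'n\<close>, with \<open>n = CARD('n) \<ge> 1\<close>; \<open>A $ i $ j\<close> is the entry in row \<open>i\<close>, column \<open>j\<close>.
\<close>

definition ell2 :: "('a, 'b) monoid_scheme \<Rightarrow> ('a \<Rightarrow> complex) set" where
  "ell2 G = {\<eta>. (\<forall>g. g \<notin> carrier G \<longrightarrow> \<eta> g = 0) \<and>
                (\<lambda>g. (cmod (\<eta> g))\<^sup>2) summable_on carrier G}"

definition ell2_real :: "('a, 'b) monoid_scheme \<Rightarrow> ('a \<Rightarrow> complex) set" where
  "ell2_real G = {\<eta> \<in> ell2 G. \<forall>g \<in> carrier G. \<eta> g \<in> \<real>}"

text \<open>
  Elements of the group ring are the finitely supported functions with support in \<open>G\<close>;
  \<open>Poly_Mapping.lookup a h\<close> is the coefficient of \<open>h\<close> in \<open>a\<close>. (The multiplication of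
  \<open>Poly_Mapping\<close>, which would require an additive monoid structure on the type \<open>'a\<close>, is not used.)
\<close>

definition group_ring :: "('a, 'b) monoid_scheme \<Rightarrow> ('a \<Rightarrow>\<^sub>0 complex) set" where
  "group_ring G = {a. Poly_Mapping.keys a \<subseteq> carrier G}"

definition group_ring_real :: "('a, 'b) monoid_scheme \<Rightarrow> ('a \<Rightarrow>\<^sub>0 complex) set" where
  "group_ring_real G = {a \<in> group_ring G. \<forall>h. Poly_Mapping.lookup a h \<in> \<real>}"

definition vecs :: "'x set \<Rightarrow> ('x ^ 'n) set" where
  "vecs S = {v. \<forall>i. v $ i \<in> S}"

definition mats :: "'x set \<Rightarrow> ('x ^ 'n ^ 'n) set" where
  "mats S = {A. \<forall>i j. A $ i $ j \<in> S}"

text \<open>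
  All the actions below are built from the one formula
  \<open>(a * b)(g) = \<Sum>h\<in>G. a(h) b(h\<^sup>-\<^sup>1 g)\<close>. In every use one of the two factors is finitely
  supported, so only finitely many terms of the sum are nonzero.
\<close>

definition conv :: "('a, 'b) monoid_scheme \<Rightarrow> ('a \<Rightarrow> complex) \<Rightarrow> ('a \<Rightarrow> complex) \<Rightarrow> 'a \<Rightarrow> complex" where
  "conv G a b g =
     (if g \<in> carrier G then \<Sum>\<^sub>\<infinity>h\<in>carrier G. a h * b (inv\<^bsub>G\<^esub> h \<otimes>\<^bsub>G\<^esub> g) else 0)"

definition lam_vec ::
  "('a, 'b) monoid_scheme \<Rightarrow> ('a \<Rightarrow>\<^sub>0 complex) ^ 'n ^ 'n \<Rightarrow> ('a \<Rightarrow> complex) ^ 'n \<Rightarrow> ('a \<Rightarrow> complex) ^ 'n" where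
  "lam_vec G f \<eta> = (\<chi> l. (\<lambda>g. \<Sum>k\<in>UNIV. conv G (Poly_Mapping.lookup (f $ l $ k)) (\<eta> $ k) g))"

definition lam_mat ::
  "('a, 'b) monoid_scheme \<Rightarrow> ('a \<Rightarrow>\<^sub>0 complex) ^ 'n ^ 'n \<Rightarrow>
     ('a \<Rightarrow> complex) ^ 'n ^ 'n \<Rightarrow> ('a \<Rightarrow> complex) ^ 'n ^ 'n" where
  "lam_mat G f \<xi> =
     (\<chi> i j. (\<lambda>g. \<Sum>k\<in>UNIV. conv G (Poly_Mapping.lookup (f $ i $ k)) (\<xi> $ k $ j) g))"

definition mat_lam ::
  "('a, 'b) monoid_scheme \<Rightarrow> ('a \<Rightarrow> complex) ^ 'n ^ 'n \<Rightarrow>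
     ('a \<Rightarrow>\<^sub>0 complex) ^ 'n ^ 'n \<Rightarrow> ('a \<Rightarrow> complex) ^ 'n ^ 'n" where
  "mat_lam G \<xi> f =
     (\<chi> i j. (\<lambda>g. \<Sum>k\<in>UNIV. conv G (\<xi> $ i $ k) (Poly_Mapping.lookup (f $ k $ j)) g))"

definition delta_id :: "('a, 'b) monoid_scheme \<Rightarrow> ('a \<Rightarrow> complex) ^ 'n ^ 'n" where
  "delta_id G = (\<chi> i j. if i = j then indicator {\<one>\<^bsub>G\<^esub>} else (\<lambda>_. 0))"


section \<open>The actions preserve square-summability\<close>

lemma ell2_zero: "(\<lambda>_. 0) \<in> ell2 G"
  by (simp add: ell2_def)

lemma ell2_add:
  assumes "x \<in> ell2 G" "y \<in> ell2 G"
  shows "(\<lambda>g. x g + y g) \<in> ell2 G"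
proof -
  have s: "(\<lambda>g. 2 * (cmod (x g))\<^sup>2 + 2 * (cmod (y g))\<^sup>2) summable_on carrier G"
    using assms by (auto simp: ell2_def intro!: summable_on_add summable_on_cmult_right)
  have "(cmod (u + v))\<^sup>2 \<le> 2 * (cmod u)\<^sup>2 + 2 * (cmod v)\<^sup>2" for u v
  proof -
    have "(cmod (u + v))\<^sup>2 \<le> (cmod u + cmod v)\<^sup>2"
      by (simp add: norm_triangle_ineq power_mono)
    also have "\<dots> \<le> 2 * (cmod u)\<^sup>2 + 2 * (cmod v)\<^sup>2"
      using sum_squares_bound[of "cmod u" "cmod v"] by (simp add: power2_sum)
    finally show ?thesis .
  qed
  then have "(\<lambda>g. (cmod (x g + y g))\<^sup>2) summable_on carrier G"
    by (intro summable_on_comparison_test[OF s]) auto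
  with assms show ?thesis by (auto simp: ell2_def)
qed

lemma ell2_sum:
  assumes "\<And>k. k \<in> K \<Longrightarrow> x k \<in> ell2 G"
  shows "(\<lambda>g. \<Sum>k\<in>K. x k g) \<in> ell2 G"
  using assms by (induction K rule: infinite_finite_induct) (auto intro: ell2_zero ell2_add)

lemma ell2_scale_reindex:
  assumes x: "x \<in> ell2 G" and p: "bij_betw p (carrier G) (carrier G)"
  shows "(\<lambda>g. if g \<in> carrier G then c * x (p g) else 0) \<in> ell2 G"
proof -
  have "(\<lambda>g. (cmod (x (p g)))\<^sup>2) summable_on carrier G"
    using x summable_on_reindex_bij_betw[OF p, of "\<lambda>g. (cmod (x g))\<^sup>2"] by (simp add: ell2_def)
  then have "(\<lambda>g. (cmod c)\<^sup>2 * (cmod (x (p g)))\<^sup>2) summable_on carrier G"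
    by (rule summable_on_cmult_right)
  then have "(\<lambda>g. (cmod (if g \<in> carrier G then c * x (p g) else 0))\<^sup>2) summable_on carrier G"
    by (rule summable_on_cong[THEN iffD1, rotated]) (simp add: norm_mult power_mult_distrib)
  then show ?thesis by (simp add: ell2_def)
qed

context group
begin

lemma bij_betw_translate_left: "h \<in> carrier G \<Longrightarrow> bij_betw (\<lambda>g. h \<otimes> g) (carrier G) (carrier G)"
  by (rule bij_betw_byWitness[where f' = "\<lambda>g. inv h \<otimes> g"]) (auto simp: m_assoc[symmetric])

lemma bij_betw_translate_right: "h \<in> carrier G \<Longrightarrow> bij_betw (\<lambda>g. g \<otimes> h) (carrier G) (carrier G)"
  by (rule bij_betw_byWitness[where f' = "\<lambda>g. g \<otimes> inv h"]) (auto simp: m_assoc)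

lemma conv_lookup_left:
  assumes "a \<in> group_ring G"
  shows "conv G (Poly_Mapping.lookup a) b g =
    (\<Sum>h\<in>Poly_Mapping.keys a.
       if g \<in> carrier G then Poly_Mapping.lookup a h * b (inv h \<otimes> g) else 0)"
proof -
  have "(\<Sum>\<^sub>\<infinity>h\<in>carrier G. Poly_Mapping.lookup a h * b (inv h \<otimes> g)) =
        (\<Sum>\<^sub>\<infinity>h\<in>Poly_Mapping.keys a. Poly_Mapping.lookup a h * b (inv h \<otimes> g))"
    using assms by (intro infsum_cong_neutral) (auto simp: group_ring_def in_keys_iff)
  then show ?thesis by (simp add: conv_def)
qed

lemma conv_lookup_right:
  assumes "a \<in> group_ring G"
  shows "conv G b (Poly_Mapping.lookup a) g =
    (\<Sum>h\<in>Poly_Mapping.keys a.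
       if g \<in> carrier G then Poly_Mapping.lookup a h * b (g \<otimes> inv h) else 0)"
proof (cases "g \<in> carrier G")
  case g: True
  have bij: "bij_betw (\<lambda>h. g \<otimes> inv h) (carrier G) (carrier G)"
    by (rule bij_betw_byWitness[where f' = "\<lambda>h. inv h \<otimes> g"])
       (use g in \<open>auto simp: m_assoc[symmetric] inv_mult_group, auto simp: m_assoc\<close>)
  have "(\<Sum>\<^sub>\<infinity>h\<in>carrier G. b h * Poly_Mapping.lookup a (inv h \<otimes> g)) =
        (\<Sum>\<^sub>\<infinity>h\<in>carrier G. b (g \<otimes> inv h) * Poly_Mapping.lookup a (inv (g \<otimes> inv h) \<otimes> g))"
    using infsum_reindex_bij_betw[OF bij, of "\<lambda>h. b h * Poly_Mapping.lookup a (inv h \<otimes> g)"] by simp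
  also have "\<dots> = (\<Sum>\<^sub>\<infinity>h\<in>Poly_Mapping.keys a. Poly_Mapping.lookup a h * b (g \<otimes> inv h))"
    using assms g
    by (intro infsum_cong_neutral)
       (auto simp: group_ring_def in_keys_iff inv_mult_group m_assoc mult.commute)
  finally show ?thesis using g by (simp add: conv_def)
qed (simp add: conv_def)

lemma conv_left_ell2:
  assumes a: "a \<in> group_ring G" and b: "b \<in> ell2 G"
  shows "conv G (Poly_Mapping.lookup a) b \<in> ell2 G"
proof -
  have "(\<lambda>g. \<Sum>h\<in>Poly_Mapping.keys a.
       if g \<in> carrier G then Poly_Mapping.lookup a h * b (inv h \<otimes> g) else 0) \<in> ell2 G"
    using a by (intro ell2_sum ell2_scale_reindex b bij_betw_translate_left)
       (auto simp: group_ring_def)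
  then show ?thesis by (simp add: conv_lookup_left[OF a, abs_def])
qed

lemma conv_right_ell2:
  assumes a: "a \<in> group_ring G" and b: "b \<in> ell2 G"
  shows "conv G b (Poly_Mapping.lookup a) \<in> ell2 G"
proof -
  have "(\<lambda>g. \<Sum>h\<in>Poly_Mapping.keys a.
       if g \<in> carrier G then Poly_Mapping.lookup a h * b (g \<otimes> inv h) else 0) \<in> ell2 G"
    using a by (intro ell2_sum ell2_scale_reindex b bij_betw_translate_right)
       (auto simp: group_ring_def)
  then show ?thesis by (simp add: conv_lookup_right[OF a, abs_def])
qed

lemma lam_vec_ell2:
  "f \<in> mats (group_ring G) \<Longrightarrow> \<eta> \<in> vecs (ell2 G) \<Longrightarrow> lam_vec G f \<eta> \<in> vecs (ell2 G)"
  by (simp add: lam_vec_def mats_def vecs_def ell2_sum conv_left_ell2)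

lemma lam_mat_ell2:
  "f \<in> mats (group_ring G) \<Longrightarrow> \<xi> \<in> mats (ell2 G) \<Longrightarrow> lam_mat G f \<xi> \<in> mats (ell2 G)"
  by (simp add: lam_mat_def mats_def ell2_sum conv_left_ell2)

lemma mat_lam_ell2:
  "f \<in> mats (group_ring G) \<Longrightarrow> \<xi> \<in> mats (ell2 G) \<Longrightarrow> mat_lam G \<xi> f \<in> mats (ell2 G)"
  by (simp add: mat_lam_def mats_def ell2_sum conv_right_ell2)

text \<open>
  A right inverse of \<open>f\<close> need not be real when \<open>f\<close> has complex coefficients: for every group and
  every \<open>n\<close>, the matrix \<open>f = \<i> \<cdot> id\<close> has the right inverse \<open>- \<i> \<cdot> \<delta>\<^sub>e \<otimes> id\<close>. Realness of a right
  inverse can therefore only be claimed for matrices over the real group ring.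
\<close>

lemma complex_right_inverse_not_real:
  "\<exists>f \<in> mats (group_ring G). \<exists>\<xi> :: ('a \<Rightarrow> complex) ^ 'n ^ 'n.
     \<xi> \<in> mats (ell2 G) \<and> lam_mat G f \<xi> = delta_id G \<and> \<xi> \<notin> mats (ell2_real G)"
proof -
  define f :: "('a \<Rightarrow>\<^sub>0 complex) ^ 'n ^ 'n"
    where "f = (\<chi> i j. if i = j then Poly_Mapping.single \<one> \<i> else 0)"
  define d where "d = (\<lambda>g. - \<i> * indicator {\<one>} g)"
  define \<xi> :: "('a \<Rightarrow> complex) ^ 'n ^ 'n" where "\<xi> = (\<chi> i j. if i = j then d else (\<lambda>_. 0))"
  have f: "f \<in> mats (group_ring G)"
    by (auto simp: f_def mats_def group_ring_def)
  have "(\<lambda>g. (cmod (d g))\<^sup>2) summable_on {\<one>}"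
    by simp
  then have "(\<lambda>g. (cmod (d g))\<^sup>2) summable_on carrier G"
    by (rule summable_on_cong_neutral[THEN iffD1, rotated -1]) (auto simp: d_def)
  then have "d \<in> ell2 G"
    by (auto simp: d_def ell2_def indicator_def)
  then have xi: "\<xi> \<in> mats (ell2 G)"
    by (auto simp: \<xi>_def mats_def ell2_zero)
  have c1: "conv G (Poly_Mapping.lookup (Poly_Mapping.single \<one> \<i>)) b g =
      (if g \<in> carrier G then \<i> * b g else 0)" for b g
    by (subst conv_lookup_left) (auto simp: group_ring_def)
  have c0: "conv G (Poly_Mapping.lookup 0) b g = 0" for b g
    by (subst conv_lookup_left) (auto simp: group_ring_def)
  have "(\<Sum>k\<in>UNIV. conv G (Poly_Mapping.lookup (f $ i $ k)) (\<xi> $ k $ j) g) =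
      (\<Sum>k\<in>UNIV. if k = i then (if g \<in> carrier G then \<i> * (\<xi> $ i $ j) g else 0) else 0)" for i j g
    by (rule sum.cong) (auto simp: f_def c1 c0)
  then have "lam_mat G f \<xi> = delta_id G"
    by (auto simp: lam_mat_def delta_id_def vec_eq_iff fun_eq_iff \<xi>_def d_def indicator_def)
  moreover have "\<xi> \<notin> mats (ell2_real G)"
  proof
    assume "\<xi> \<in> mats (ell2_real G)"
    then have "(\<xi> $ undefined $ undefined) \<one> \<in> \<real>"
      by (auto simp: mats_def ell2_real_def)
    then show False
      by (simp add: \<xi>_def d_def complex_is_Real_iff)
  qed
  ultimately show ?thesis using f xi by blast
qed

end

end

theory Submission
  imports Defs
begin

section \<open>Square-summable functions on a set\<close>

text \<open>The engine is the trace, as in the proof that a finite von Neumann algebra is directly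
  finite. Let \<open>K\<close> be the kernel of \<lambda>(f) on l^2(G)^n; it is closed and invariant
  under right translation. Subtracting from each column of \<xi> its orthogonal projection onto
  \<open>K\<close> gives \<open>Y\<close> with columns orthogonal to \<open>K\<close> and still f Y
  = id. The columns of Y f are finite combinations of right translates of columns of
  \<open>Y\<close>, so they are orthogonal to \<open>K\<close> too, while f (Y f) = (f Y) f = f puts
  the columns of E = id - Y f into \<open>K\<close>. Hence id = Y f + E is an orthogonal
  decomposition, and the squared norms of the columns of E add up to n - tr(Y f) = n - tr(f Y) = 0.
  So the unit columns are orthogonal to \<open>K\<close>, and translation invariance gives K = 0.
  Every product has f as a factor, so \<xi> need not act as a bounded operator.

  The ingredients are \<open>orthogonal_projection_exists\<close>, \<open>ip_translate\<close>,
  \<open>lact_ract\<close> and \<open>trace_ract\<close>; they meet in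
  \<open>right_invertible_imp_trivial_kernel\<close>. Then (i) is the trivial kernel and (ii) is the
  same column by column. For (iii), \<xi> f and id have the same image f under \<lambda>(f). For
  (iv), with f real, the complex conjugate of \<xi> is a right inverse as well.\<close>

definition l2 :: "'x set \<Rightarrow> ('x \<Rightarrow> complex) set" where
  "l2 A = {x. (\<lambda>a. (cmod (x a))\<^sup>2) summable_on A}"

definition ip :: "'x set \<Rightarrow> ('x \<Rightarrow> complex) \<Rightarrow> ('x \<Rightarrow> complex) \<Rightarrow> complex" where
  "ip A x y = (\<Sum>\<^sub>\<infinity>a\<in>A. x a * cnj (y a))"

definition sqnorm :: "'x set \<Rightarrow> ('x \<Rightarrow> complex) \<Rightarrow> real" where
  "sqnorm A x = (\<Sum>\<^sub>\<infinity>a\<in>A. (cmod (x a))\<^sup>2)"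

lemma cmod_parallelogram: "(cmod (u + v))\<^sup>2 + (cmod (u - v))\<^sup>2 = 2 * (cmod u)\<^sup>2 + 2 * (cmod v)\<^sup>2"
  by (simp add: cmod_power2 power2_sum power2_diff)

text \<open>Guards against the default value 0 that \<open>infsum\<close> takes on a divergent sum:
  the terms of \<open>ip\<close> are dominated by the sum of the two squares.\<close>

lemma l2_mult_summable:
  assumes "x \<in> l2 A" "y \<in> l2 A"
  shows "(\<lambda>a. x a * cnj (y a)) summable_on A"
proof -
  have s: "(\<lambda>a. (cmod (x a))\<^sup>2 + (cmod (y a))\<^sup>2) summable_on A"
    using assms by (auto simp: l2_def intro!: summable_on_add)
  have "cmod (u * cnj v) \<le> (cmod u)\<^sup>2 + (cmod v)\<^sup>2" for u v
    using sum_squares_bound[of "cmod u" "cmod v"]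
      mult_nonneg_nonneg[OF norm_ge_zero[of u] norm_ge_zero[of v]]
    unfolding norm_mult complex_mod_cnj by linarith
  then have "(\<lambda>a. norm (x a * cnj (y a))) summable_on A"
    by (intro summable_on_comparison_test[OF s]) auto
  then show ?thesis
    by (rule abs_summable_summable)
qed

lemma l2_scale: "x \<in> l2 A \<Longrightarrow> (\<lambda>a. c * x a) \<in> l2 A"
  by (auto simp: l2_def norm_mult power_mult_distrib intro: summable_on_cmult_right)

lemma l2_add:
  assumes "x \<in> l2 A" "y \<in> l2 A"
  shows "(\<lambda>a. x a + y a) \<in> l2 A"
proof -
  have s: "(\<lambda>a. 2 * (cmod (x a))\<^sup>2 + 2 * (cmod (y a))\<^sup>2) summable_on A"
    using assms by (auto simp: l2_def intro!: summable_on_add summable_on_cmult_right)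
  have "(cmod (u + v))\<^sup>2 \<le> 2 * (cmod u)\<^sup>2 + 2 * (cmod v)\<^sup>2" for u v
    using cmod_parallelogram[of u v] zero_le_power2[of "cmod (u - v)"]
    by linarith
  then show ?thesis
    unfolding l2_def by (auto intro!: summable_on_comparison_test[OF s])
qed

lemma l2_diff:
  assumes "x \<in> l2 A" "y \<in> l2 A"
  shows "(\<lambda>a. x a - y a) \<in> l2 A"
  using l2_add[OF assms(1) l2_scale[OF assms(2), of "-1"]] by simp

lemma l2_zero: "(\<lambda>_. 0) \<in> l2 A"
  by (simp add: l2_def)

lemma l2_sum: "(\<And>k. k \<in> I \<Longrightarrow> x k \<in> l2 A) \<Longrightarrow> (\<lambda>a. \<Sum>k\<in>I. x k a) \<in> l2 A"
  by (induction I rule: infinite_finite_induct) (auto intro: l2_zero l2_add)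

lemma l2_reindex:
  assumes "bij_betw p A A" "x \<in> l2 A"
  shows "(\<lambda>a. x (p a)) \<in> l2 A"
  using assms(2) summable_on_reindex_bij_betw[OF assms(1), of "\<lambda>a. (cmod (x a))\<^sup>2"]
  by (simp add: l2_def)

lemma ip_add:
  assumes "x \<in> l2 A" "y \<in> l2 A" "z \<in> l2 A"
  shows "ip A (\<lambda>a. x a + y a) z = ip A x z + ip A y z"
  using assms unfolding ip_def
  by (subst infsum_add[symmetric]) (auto intro: l2_mult_summable simp: algebra_simps)

lemma ip_scale: "ip A (\<lambda>a. c * x a) z = c * ip A x z"
  unfolding ip_def by (simp add: mult.assoc infsum_cmult_right')

lemma ip_diff:
  assumes "x \<in> l2 A" "y \<in> l2 A" "z \<in> l2 A"
  shows "ip A (\<lambda>a. x a - y a) z = ip A x z - ip A y z"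
  using ip_add[OF assms(1) l2_scale[OF assms(2), of "-1"] assms(3)] ip_scale[of A "-1" y z]
  by simp

lemma ip_sum:
  assumes "\<And>k. k \<in> I \<Longrightarrow> x k \<in> l2 A" "z \<in> l2 A"
  shows "ip A (\<lambda>a. \<Sum>k\<in>I. x k a) z = (\<Sum>k\<in>I. ip A (x k) z)"
  using assms(1)
proof (induction I rule: infinite_finite_induct)
  case (insert k I)
  then show ?case
    by (simp add: ip_add l2_sum assms(2))
qed (simp_all add: ip_def)

lemma ip_commute: "ip A y x = cnj (ip A x y)"
  unfolding ip_def by (simp add: infsum_cnj[symmetric] mult.commute)

lemma ip_self:
  assumes "x \<in> l2 A"
  shows "ip A x x = of_real (sqnorm A x)"
proof -
  have "((\<lambda>a. (cmod (x a))\<^sup>2) has_sum sqnorm A x) A"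
    using assms by (simp add: l2_def sqnorm_def)
  then have "((\<lambda>a. x a * cnj (x a)) has_sum of_real (sqnorm A x)) A"
    unfolding complex_norm_square[symmetric] by (rule has_sum_of_real)
  then show ?thesis
    unfolding ip_def by (rule infsumI)
qed

lemma ip_reindex:
  assumes "bij_betw p A A"
  shows "ip A (\<lambda>a. x (p a)) (\<lambda>a. y (p a)) = ip A x y"
  unfolding ip_def using infsum_reindex_bij_betw[OF assms, of "\<lambda>a. x a * cnj (y a)"] by simp

lemma sqnorm_nonneg: "sqnorm A x \<ge> 0"
  unfolding sqnorm_def by (rule infsum_nonneg) simp

lemma sum_le_sqnorm:
  assumes "x \<in> l2 A" "finite F" "F \<subseteq> A"
  shows "(\<Sum>a\<in>F. (cmod (x a))\<^sup>2) \<le> sqnorm A x"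
  unfolding sqnorm_def using assms
  by (intro finite_sum_le_infsum) (auto simp: l2_def)

text \<open>Evaluation at a point is continuous for the norm. This makes a minimising sequence
  pointwise Cauchy, and turns norm 0 into pointwise vanishing.\<close>

lemma pointwise_le_sqnorm: "x \<in> l2 A \<Longrightarrow> a \<in> A \<Longrightarrow> (cmod (x a))\<^sup>2 \<le> sqnorm A x"
  using sum_le_sqnorm[of x A "{a}"] by simp

lemma sqnorm_scale: "sqnorm A (\<lambda>a. c * x a) = (cmod c)\<^sup>2 * sqnorm A x"
  unfolding sqnorm_def by (simp add: norm_mult power_mult_distrib infsum_cmult_right')

lemma sqnorm_parallelogram:
  assumes "x \<in> l2 A" "y \<in> l2 A"
  shows "sqnorm A (\<lambda>a. x a + y a) + sqnorm A (\<lambda>a. x a - y a) = 2 * sqnorm A x + 2 * sqnorm A y"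
proof -
  have "sqnorm A (\<lambda>a. x a + y a) + sqnorm A (\<lambda>a. x a - y a) =
      (\<Sum>\<^sub>\<infinity>a\<in>A. (cmod (x a + y a))\<^sup>2 + (cmod (x a - y a))\<^sup>2)"
    unfolding sqnorm_def using l2_add[OF assms] l2_diff[OF assms]
    by (intro infsum_add[symmetric]) (auto simp: l2_def)
  also have "\<dots> = (\<Sum>\<^sub>\<infinity>a\<in>A. 2 * (cmod (x a))\<^sup>2 + 2 * (cmod (y a))\<^sup>2)"
    by (simp add: cmod_parallelogram)
  also have "\<dots> = 2 * sqnorm A x + 2 * sqnorm A y"
    unfolding sqnorm_def using assms
    by (subst infsum_add) (auto simp: l2_def infsum_cmult_right' intro: summable_on_cmult_right)
  finally show ?thesis .
qed

section \<open>Orthogonal projection onto a closed subspace\<close>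

text \<open>The factor \<open>c\<close> aligns the phase of the step with the inner product, so the
  cross term is real: the result is a quadratic in \<open>s\<close> whose linear term is negative
  unless \<open>c\<close> is 0.\<close>

lemma sqnorm_diff_scale:
  fixes A x k
  defines "c \<equiv> ip A x k"
  assumes "x \<in> l2 A" "k \<in> l2 A"
  shows "sqnorm A (\<lambda>a. x a - (of_real s * c) * k a) =
    sqnorm A x - 2 * s * (cmod c)\<^sup>2 + s\<^sup>2 * (cmod c)\<^sup>2 * sqnorm A k"
proof -
  let ?w = "\<lambda>a. (of_real s * c) * k a" and ?z = "\<lambda>a. x a - (of_real s * c) * k a"
  have w: "?w \<in> l2 A" by (intro l2_scale assms)
  have z: "?z \<in> l2 A" by (intro l2_diff w assms)
  have xw: "ip A x ?w = of_real s * cnj c * c"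
    using ip_scale[of A "of_real s * c" k x] ip_commute[of A x k]
    by (subst ip_commute) (simp add: c_def)
  have kk: "ip A ?w ?w = (of_real s * c) * (of_real s * cnj c * of_real (sqnorm A k))"
    by (subst ip_scale, subst ip_commute, subst ip_scale) (simp add: ip_self assms)
  have cc: "(complex_of_real (cmod c))\<^sup>2 = c * cnj c"
    using complex_norm_square[of c] by simp
  have "of_real (sqnorm A ?z) = ip A ?z ?z" by (rule ip_self[OF z, symmetric])
  also have "\<dots> = ip A x ?z - ip A ?w ?z" by (intro ip_diff assms w z)
  also have "ip A x ?z = cnj (ip A x x - ip A ?w x)"
    by (subst ip_commute, subst ip_diff) (use assms w in auto)
  also have "ip A ?w ?z = cnj (ip A x ?w - ip A ?w ?w)"
    by (subst ip_commute, subst ip_diff) (use assms w in auto)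
  also have "ip A ?w x = cnj (ip A x ?w)" by (rule ip_commute)
  finally have "complex_of_real (sqnorm A ?z) =
      of_real (sqnorm A x - 2 * s * (cmod c)\<^sup>2 + s\<^sup>2 * (cmod c)\<^sup>2 * sqnorm A k)"
    unfolding xw kk unfolding ip_self[OF assms(2)]
    by (simp add: cc algebra_simps power2_eq_square[of "complex_of_real s"])
  then show ?thesis
    by (simp only: of_real_eq_iff)
qed

text \<open>
  As the subspace is closed under pointwise convergence, the pointwise limit of a minimising
  sequence is a minimiser, and completeness of \<open>\<ell>\<^sup>2\<close> is not needed.
\<close>

lemma orthogonal_projection_exists:
  assumes K: "K \<subseteq> l2 A" "K \<noteq> {}"
    and add: "\<And>x y. x \<in> K \<Longrightarrow> y \<in> K \<Longrightarrow> (\<lambda>a. x a + y a) \<in> K"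
    and scale: "\<And>x c. x \<in> K \<Longrightarrow> (\<lambda>a. c * x a) \<in> K"
    and closed: "\<And>X p. (\<And>m. X m \<in> K) \<Longrightarrow> p \<in> l2 A \<Longrightarrow>
      (\<And>a. a \<in> A \<Longrightarrow> (\<lambda>m. X m a) \<longlonglongrightarrow> p a) \<Longrightarrow> p \<in> K"
    and x: "x \<in> l2 A"
  obtains p where "p \<in> K" "\<And>k. k \<in> K \<Longrightarrow> ip A (\<lambda>a. x a - p a) k = 0"
proof -
  define d where "d = (INF k\<in>K. sqnorm A (\<lambda>a. x a - k a))"
  have bdd: "bdd_below ((\<lambda>k. sqnorm A (\<lambda>a. x a - k a)) ` K)"
    by (intro bdd_belowI2[of _ 0] sqnorm_nonneg)
  have d_le: "d \<le> sqnorm A (\<lambda>a. x a - k a)" if "k \<in> K" for k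
    unfolding d_def using bdd that by (rule cINF_lower)
  have "\<exists>k\<in>K. sqnorm A (\<lambda>a. x a - k a) < d + inverse (real (Suc m))" for m
    using cINF_less_iff[OF K(2) bdd, of "d + inverse (real (Suc m))"] by (simp add: d_def)
  then obtain X where XK: "X m \<in> K"
    and X: "sqnorm A (\<lambda>a. x a - X m a) < d + inverse (real (Suc m))" for m
    by metis
  have Xl2: "X m \<in> l2 A" for m using XK K by auto
  have near: "sqnorm A (\<lambda>a. X m a - X l a) \<le>
      2 * inverse (real (Suc m)) + 2 * inverse (real (Suc l))" for m l
  proof -
    \<comment> \<open>The midpoint lies in \<open>K\<close>, so its distance to \<open>x\<close> is
      at least the infimum; the parallelogram law then bounds the gap between two members of the
      sequence.\<close>
    define w where "w = (\<lambda>a. (1/2) * (X m a + X l a))"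
    have "w \<in> K" unfolding w_def by (intro scale add XK)
    then have "4 * d \<le> 4 * sqnorm A (\<lambda>a. x a - w a)" using d_le by simp
    also have "\<dots> = sqnorm A (\<lambda>a. (x a - X m a) + (x a - X l a))"
      using sqnorm_scale[of A 2 "\<lambda>a. x a - w a"] by (simp add: w_def algebra_simps)
    finally have "4 * d \<le> sqnorm A (\<lambda>a. (x a - X m a) + (x a - X l a))" .
    moreover have "sqnorm A (\<lambda>a. (x a - X m a) - (x a - X l a)) = sqnorm A (\<lambda>a. X m a - X l a)"
      by (simp add: sqnorm_def norm_minus_commute)
    ultimately show ?thesis
      using sqnorm_parallelogram[OF l2_diff[OF x Xl2[of m]] l2_diff[OF x Xl2[of l]]] X[of m] X[of l]
      by linarith
  qed
  have "Cauchy (\<lambda>m. X m a)" if "a \<in> A" for a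
  proof (rule metric_CauchyI)
    fix e :: real assume e: "e > 0"
    obtain M where M: "inverse (real (Suc M)) < e\<^sup>2 / 4"
      using reals_Archimedean[of "e\<^sup>2 / 4"] e by auto
    have "dist (X m a) (X l a) < e" if "m \<ge> M" "l \<ge> M" for m l
    proof -
      have "inverse (real (Suc m)) \<le> inverse (real (Suc M))"
        "inverse (real (Suc l)) \<le> inverse (real (Suc M))"
        using that by (auto intro!: le_imp_inverse_le)
      then have "(cmod (X m a - X l a))\<^sup>2 < e\<^sup>2"
        using near[of m l] M pointwise_le_sqnorm[OF l2_diff[OF Xl2[of m] Xl2[of l]] \<open>a \<in> A\<close>]
        by linarith
      then show ?thesis using e by (simp add: dist_norm power2_less_imp_less)
    qed
    then show "\<exists>M. \<forall>m\<ge>M. \<forall>n\<ge>M. dist (X m a) (X n a) < e" by blast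
  qed
  define p where "p a = lim (\<lambda>m. X m a)" for a
  have lim: "(\<lambda>m. X m a) \<longlonglongrightarrow> p a" if "a \<in> A" for a
    unfolding p_def using \<open>a \<in> A \<Longrightarrow> Cauchy _\<close> that Cauchy_convergent_iff convergent_LIMSEQ_iff by blast
  \<comment> \<open>A Fatou argument: the bound passes to the limit on finite sets, which yields
    both square-summability of \<open>x - p\<close> and minimality of \<open>p\<close>.\<close>
  have fin: "(\<Sum>a\<in>F. (cmod (x a - p a))\<^sup>2) \<le> d" if F: "finite F" "F \<subseteq> A" for F
  proof (rule tendsto_le[OF sequentially_bot])
    show "(\<lambda>m. \<Sum>a\<in>F. (cmod (x a - X m a))\<^sup>2) \<longlonglongrightarrow> (\<Sum>a\<in>F. (cmod (x a - p a))\<^sup>2)"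
      using F by (intro tendsto_intros lim) auto
    show "(\<lambda>m. d + inverse (real (Suc m))) \<longlonglongrightarrow> d"
      using tendsto_add[OF tendsto_const[of d] LIMSEQ_inverse_real_of_nat] by simp
    show "\<forall>\<^sub>F m in sequentially. (\<Sum>a\<in>F. (cmod (x a - X m a))\<^sup>2) \<le> d + inverse (real (Suc m))"
      using sum_le_sqnorm[OF l2_diff[OF x Xl2] F] X
      by (intro always_eventually allI less_imp_le) (rule order.strict_trans1)
  qed
  have yl2: "(\<lambda>a. x a - p a) \<in> l2 A"
    unfolding l2_def using fin
    by (auto intro!: nonneg_bdd_above_summable_on bdd_aboveI2)
  have y_le: "sqnorm A (\<lambda>a. x a - p a) \<le> d"
    unfolding sqnorm_def using yl2 fin by (intro infsum_le_finite_sums) (auto simp: l2_def)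
  have "p \<in> l2 A" using l2_diff[OF x yl2] by simp
  then have pK: "p \<in> K" using closed[of X p] XK lim by blast
  have "ip A (\<lambda>a. x a - p a) k = 0" if k: "k \<in> K" for k
  proof -
    \<comment> \<open>The step \<open>s\<close> is small enough that the quadratic term cannot
      outweigh the linear one; the added 1 keeps the denominator positive when \<open>k\<close> has
      norm 0.\<close>
    define c s where "c = ip A (\<lambda>a. x a - p a) k" and "s = 1 / (1 + sqnorm A k)"
    have s: "s > 0" "s * sqnorm A k < 1"
      using sqnorm_nonneg[of A k] by (auto simp: s_def field_simps)
    have "(\<lambda>a. p a + (of_real s * c) * k a) \<in> K" by (intro add scale pK k)
    then have "d \<le> sqnorm A (\<lambda>a. (x a - p a) - (of_real s * c) * k a)"
      using d_le by (fastforce simp: algebra_simps)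
    also have "\<dots> = sqnorm A (\<lambda>a. x a - p a) - 2 * s * (cmod c)\<^sup>2 + s\<^sup>2 * (cmod c)\<^sup>2 * sqnorm A k"
      unfolding c_def using yl2 K k by (intro sqnorm_diff_scale) auto
    finally have "s * ((cmod c)\<^sup>2 * (2 - s * sqnorm A k)) \<le> 0"
      using y_le by (simp add: algebra_simps power2_eq_square)
    then have "(cmod c)\<^sup>2 * (2 - s * sqnorm A k) \<le> 0"
      using s(1) by (simp add: mult_le_0_iff)
    then show ?thesis
      using s(2) by (simp add: mult_le_0_iff c_def)
  qed
  with pK that show ?thesis by blast
qed

section \<open>Kernels of matrices over the group ring\<close>

text \<open>
  An element of \<open>\<ell>\<^sup>2(G)\<^sup>n\<close> is treated as a single function on \<open>{1..n} \<times> G\<close>; a matrix is treated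
  as the family of its columns, indexed by \<open>'n\<close>.
\<close>

definition lact :: "('a, 'b) monoid_scheme \<Rightarrow> ('a \<Rightarrow>\<^sub>0 complex) ^ 'n ^ 'n \<Rightarrow>
    ('n \<times> 'a \<Rightarrow> complex) \<Rightarrow> 'n \<Rightarrow> 'a \<Rightarrow> complex" where
  "lact G f v l g = (\<Sum>k\<in>UNIV. \<Sum>h\<in>Poly_Mapping.keys (f $ l $ k).
     Poly_Mapping.lookup (f $ l $ k) h * v (k, inv\<^bsub>G\<^esub> h \<otimes>\<^bsub>G\<^esub> g))"

text \<open>Column \<open>j\<close> of Y f. The convolution is reindexed by the support of f, which
  exhibits it as a finite combination of right translates of the columns of
  \<open>Y\<close>.\<close>

definition ract :: "('a, 'b) monoid_scheme \<Rightarrow> ('n \<Rightarrow> 'n \<times> 'a \<Rightarrow> complex) \<Rightarrow>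
    ('a \<Rightarrow>\<^sub>0 complex) ^ 'n ^ 'n \<Rightarrow> 'n \<Rightarrow> 'n \<times> 'a \<Rightarrow> complex" where
  "ract G Y f j = (\<lambda>(i, g). \<Sum>k\<in>UNIV. \<Sum>h\<in>Poly_Mapping.keys (f $ k $ j).
     Poly_Mapping.lookup (f $ k $ j) h * Y k (i, g \<otimes>\<^bsub>G\<^esub> inv\<^bsub>G\<^esub> h))"

definition unit_col :: "('a, 'b) monoid_scheme \<Rightarrow> 'n \<Rightarrow> 'n \<times> 'a \<Rightarrow> complex" where
  "unit_col G j = (\<lambda>(i, g). if i = j \<and> g = \<one>\<^bsub>G\<^esub> then 1 else 0)"

lemma lact_add: "lact G f (\<lambda>a. v a + w a) l g = lact G f v l g + lact G f w l g"
  by (simp add: lact_def algebra_simps sum.distrib)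

lemma lact_diff: "lact G f (\<lambda>a. v a - w a) l g = lact G f v l g - lact G f w l g"
  by (simp add: lact_def algebra_simps sum_subtractf)

lemma lact_scale: "lact G f (\<lambda>a. c * v a) l g = c * lact G f v l g"
  by (simp add: lact_def sum_distrib_left algebra_simps)

lemma lact_sum: "lact G f (\<lambda>a. \<Sum>m\<in>I. v m a) l g = (\<Sum>m\<in>I. lact G f (v m) l g)"
  by (induction I rule: infinite_finite_induct) (simp_all add: lact_add, simp_all add: lact_def)

context group
begin

lemma sum_keys_delta:
  fixes c :: "'x \<Rightarrow>\<^sub>0 complex"
  assumes "\<And>h. h \<in> Poly_Mapping.keys c \<Longrightarrow> P h \<longleftrightarrow> h = g"
  shows "(\<Sum>h\<in>Poly_Mapping.keys c. Poly_Mapping.lookup c h * (if P h then 1 else 0)) =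
    Poly_Mapping.lookup c g"
proof -
  have "(\<Sum>h\<in>Poly_Mapping.keys c. Poly_Mapping.lookup c h * (if P h then 1 else 0)) =
      (\<Sum>h\<in>Poly_Mapping.keys c. if h = g then Poly_Mapping.lookup c h else 0)"
    using assms by (intro sum.cong) auto
  then show ?thesis by (simp add: in_keys_iff)
qed

lemma keys_carrier:
  "f \<in> mats (group_ring G) \<Longrightarrow> h \<in> Poly_Mapping.keys (f $ i $ j) \<Longrightarrow> h \<in> carrier G"
  by (auto simp: mats_def group_ring_def)

text \<open>Left and right multiplication commute. Hence the kernel of \<lambda>(f) is invariant
  under right translation.\<close>

lemma lact_translate:
  assumes "f \<in> mats (group_ring G)" "g \<in> carrier G" "h \<in> carrier G"
  shows "lact G f (\<lambda>(i, g). v (i, g \<otimes> h)) l g = lact G f v l (g \<otimes> h)"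
  using assms by (auto simp: lact_def m_assoc keys_carrier intro!: sum.cong)

lemma lact_unit_col:
  assumes f: "f \<in> mats (group_ring G)" and g: "g \<in> carrier G"
  shows "lact G f (unit_col G j) l g = Poly_Mapping.lookup (f $ l $ j) g"
proof -
  have eq: "inv h \<otimes> g = \<one> \<longleftrightarrow> h = g" if "h \<in> carrier G" for h
    using that g by (metis inv_closed inv_equality inv_inv l_inv)
  have "lact G f (unit_col G j) l g =
      (\<Sum>k\<in>UNIV. if k = j then Poly_Mapping.lookup (f $ l $ j) g else 0)"
    unfolding lact_def unit_col_def
    by (intro sum.cong) (simp_all add: sum_keys_delta eq keys_carrier[OF f])
  also have "\<dots> = Poly_Mapping.lookup (f $ l $ j) g"
    by simp
  finally show ?thesis .
qed

text \<open>Associativity, f (Y f) = (f Y) f = f, for a right inverse \<open>Y\<close>. By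
  \<open>lact_unit_col\<close> the identity has the same image, so id - Y f is killed by f.\<close>

lemma lact_ract:
  assumes f: "f \<in> mats (group_ring G)" and g: "g \<in> carrier G"
    and Y: "\<And>i j g. g \<in> carrier G \<Longrightarrow> lact G f (Y j) i g = unit_col G j (i, g)"
  shows "lact G f (ract G Y f j) l g = Poly_Mapping.lookup (f $ l $ j) g"
proof -
  have eq: "g \<otimes> inv h = \<one> \<longleftrightarrow> h = g" if "h \<in> carrier G" for h
    using that g by (metis inv_closed inv_equality inv_inv r_inv)
  have "ract G Y f j = (\<lambda>a. \<Sum>k\<in>UNIV. \<Sum>h\<in>Poly_Mapping.keys (f $ k $ j).
     Poly_Mapping.lookup (f $ k $ j) h * (\<lambda>(i, g). Y k (i, g \<otimes> inv h)) a)"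
    by (auto simp: ract_def fun_eq_iff)
  then have "lact G f (ract G Y f j) l g = (\<Sum>k\<in>UNIV. \<Sum>h\<in>Poly_Mapping.keys (f $ k $ j).
     Poly_Mapping.lookup (f $ k $ j) h * lact G f (\<lambda>(i, g). Y k (i, g \<otimes> inv h)) l g)"
    by (simp only: lact_sum lact_scale)
  also have "\<dots> = (\<Sum>k\<in>UNIV. \<Sum>h\<in>Poly_Mapping.keys (f $ k $ j).
     Poly_Mapping.lookup (f $ k $ j) h * unit_col G k (l, g \<otimes> inv h))"
    using g by (intro sum.cong) (auto simp: lact_translate[OF f] keys_carrier[OF f] Y)
  also have "\<dots> = (\<Sum>k\<in>UNIV. if k = l then Poly_Mapping.lookup (f $ l $ j) g else 0)"
    unfolding unit_col_def
    by (intro sum.cong) (simp_all add: sum_keys_delta eq keys_carrier[OF f])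
  also have "\<dots> = Poly_Mapping.lookup (f $ l $ j) g"
    by simp
  finally show ?thesis .
qed

text \<open>tr(Y f) = tr(f Y), where tr adds the diagonal entries at the identity of G. There left
  and right translation by \<open>inv h\<close> agree, and what remains is an exchange of finite
  sums.\<close>

lemma trace_ract:
  assumes f: "f \<in> mats (group_ring G)"
  shows "(\<Sum>j\<in>UNIV. ract G Y f j (j, \<one>)) = (\<Sum>j\<in>UNIV. lact G f (Y j) j \<one>)"
proof -
  have "(\<Sum>j\<in>UNIV. ract G Y f j (j, \<one>)) = (\<Sum>j\<in>UNIV. \<Sum>k\<in>UNIV. \<Sum>h\<in>Poly_Mapping.keys (f $ k $ j).
     Poly_Mapping.lookup (f $ k $ j) h * Y k (j, inv h \<otimes> \<one>))"
    unfolding ract_def by (auto simp: keys_carrier[OF f] intro!: sum.cong)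
  also have "\<dots> = (\<Sum>k\<in>UNIV. lact G f (Y k) k \<one>)"
    unfolding lact_def by (rule sum.swap)
  finally show ?thesis .
qed

section \<open>Right translations are unitary; triviality of the kernel\<close>

lemma bij_betw_translate_pair:
  "h \<in> carrier G \<Longrightarrow> bij_betw (\<lambda>(i, g). (i, g \<otimes> h)) (UNIV \<times> carrier G) (UNIV \<times> carrier G)"
  by (rule bij_betw_byWitness[where f' = "\<lambda>(i, g). (i, g \<otimes> inv h)"]) (auto simp: m_assoc)

lemma l2_translate:
  assumes "h \<in> carrier G" "x \<in> l2 (UNIV \<times> carrier G)"
  shows "(\<lambda>(i, g). x (i, g \<otimes> h)) \<in> l2 (UNIV \<times> carrier G)"
  using l2_reindex[OF bij_betw_translate_pair[OF assms(1)] assms(2)]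
  by (simp add: case_prod_unfold)

text \<open>The adjoint of a right translation is the inverse translation. It moves translates of
  \<open>Y\<close> onto elements of the kernel.\<close>

lemma ip_translate:
  assumes h: "h \<in> carrier G"
  shows "ip (UNIV \<times> carrier G) (\<lambda>(i, g). x (i, g \<otimes> inv h)) y =
    ip (UNIV \<times> carrier G) x (\<lambda>(i, g). y (i, g \<otimes> h))"
proof -
  have "ip (UNIV \<times> carrier G) (\<lambda>(i, g). x (i, g \<otimes> inv h)) y =
    ip (UNIV \<times> carrier G) (\<lambda>(i, g). x (i, g \<otimes> inv h))
      (\<lambda>a. (\<lambda>(i, g). y (i, g \<otimes> h)) ((\<lambda>(i, g). (i, g \<otimes> inv h)) a))"
    unfolding ip_def using h by (intro infsum_cong) (auto simp: m_assoc)
  also have "\<dots> = ip (UNIV \<times> carrier G) x (\<lambda>(i, g). y (i, g \<otimes> h))"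
    using ip_reindex[OF bij_betw_translate_pair, of "inv h" x "\<lambda>(i, g). y (i, g \<otimes> h)"] h by (simp add: case_prod_unfold)
  finally show ?thesis .
qed

lemma unit_col_l2: "unit_col G (j :: 'n::finite) \<in> l2 (UNIV \<times> carrier G)"
proof -
  have "(\<lambda>a. (cmod (unit_col G j a))\<^sup>2) summable_on {(j, \<one>)}"
    by simp
  then show ?thesis
    unfolding l2_def
    by (subst mem_Collect_eq, rule summable_on_cong_neutral[THEN iffD1, rotated -1])
       (auto simp: unit_col_def split: if_splits)
qed

lemma ip_unit_col: "ip (UNIV \<times> carrier G) x (unit_col G j) = x (j, \<one>)"
proof -
  have "ip (UNIV \<times> carrier G) x (unit_col G j) = (\<Sum>\<^sub>\<infinity>a\<in>{(j, \<one>)}. x a)"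
    unfolding ip_def by (rule infsum_cong_neutral) (auto simp: unit_col_def split: if_splits)
  then show ?thesis by simp
qed

text \<open>
  The columns \<open>Y\<close> of the right inverse are made orthogonal to the kernel \<open>K\<close>. Then \<open>Y f\<close> is the
  orthogonal projection of the identity onto the complement of \<open>K\<close>, and the trace identity
  \<open>tr (Y f) = tr (f Y) = n\<close> forces this projection to be the identity.
\<close>

lemma right_invertible_imp_trivial_kernel:
  fixes f :: "('a \<Rightarrow>\<^sub>0 complex) ^ 'n ^ 'n"
  assumes f: "f \<in> mats (group_ring G)"
    and X: "\<And>j. X j \<in> l2 (UNIV \<times> carrier G)"
    and inv: "\<And>i j g. g \<in> carrier G \<Longrightarrow> lact G f (X j) i g = unit_col G j (i, g)"
    and v: "v \<in> l2 (UNIV \<times> carrier G)"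
    and ker: "\<And>i g. g \<in> carrier G \<Longrightarrow> lact G f v i g = 0"
    and g: "g \<in> carrier G"
  shows "v (i, g) = 0"
proof -
  let ?A = "UNIV \<times> carrier G :: ('n \<times> 'a) set"
  define K where "K = {v \<in> l2 ?A. \<forall>i. \<forall>g\<in>carrier G. lact G f v i g = 0}"
  have "\<exists>p\<in>K. \<forall>k\<in>K. ip ?A (\<lambda>a. X j a - p a) k = 0" for j
  proof (rule orthogonal_projection_exists[of K ?A "X j"])
    show "K \<noteq> {}" using v ker by (auto simp: K_def)
    fix Z p assume Z: "\<And>m. Z m \<in> K" and p: "p \<in> l2 ?A"
      and lim: "\<And>a. a \<in> ?A \<Longrightarrow> (\<lambda>m. Z m a) \<longlonglongrightarrow> p a"
    \<comment> \<open>Each value of \<open>lact\<close> involves finitely many values of its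
      argument, so it is continuous under pointwise convergence.\<close>
    have "lact G f p i g = 0" if "g \<in> carrier G" for i g
    proof (rule LIMSEQ_unique)
      show "(\<lambda>m. lact G f (Z m) i g) \<longlonglongrightarrow> lact G f p i g"
        unfolding lact_def using that by (intro tendsto_intros lim) (auto simp: keys_carrier[OF f])
      show "(\<lambda>m. lact G f (Z m) i g) \<longlonglongrightarrow> 0"
        using Z that by (simp add: K_def)
    qed
    with p show "p \<in> K" by (simp add: K_def)
  qed (auto simp: K_def X l2_add l2_scale lact_add lact_scale)
  then obtain P where PK: "P j \<in> K"
    and orth: "k \<in> K \<Longrightarrow> ip ?A (\<lambda>a. X j a - P j a) k = 0" for j k
    by metis
  define Y where "Y j = (\<lambda>a. X j a - P j a)" for j
  define U where "U j = ract G Y f j" for j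
  have Yl2: "Y j \<in> l2 ?A" for j
    unfolding Y_def using X PK by (auto simp: K_def intro: l2_diff)
  have Yinv: "lact G f (Y j) i g = unit_col G j (i, g)" if "g \<in> carrier G" for i j g
    using that PK by (simp add: Y_def lact_diff inv K_def)
  have shift: "(\<lambda>(i, g). k (i, g \<otimes> h)) \<in> K" if "k \<in> K" "h \<in> carrier G" for k h
    using that by (auto simp: K_def l2_translate lact_translate[OF f])
  have U_eq: "U j = (\<lambda>a. \<Sum>k\<in>UNIV. \<Sum>h\<in>Poly_Mapping.keys (f $ k $ j).
     Poly_Mapping.lookup (f $ k $ j) h * (\<lambda>(i, g). Y k (i, g \<otimes> inv h)) a)" for j
    by (auto simp: U_def ract_def fun_eq_iff)
  have tl2: "(\<lambda>a. Poly_Mapping.lookup (f $ k $ j) h * (\<lambda>(i, g). Y k (i, g \<otimes> inv h)) a) \<in> l2 ?A"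
    if "h \<in> Poly_Mapping.keys (f $ k $ j)" for h k j
    using that by (intro l2_scale l2_translate Yl2) (auto simp: keys_carrier[OF f])
  have Ul2: "U j \<in> l2 ?A" for j
    unfolding U_eq by (intro l2_sum tl2)
  \<comment> \<open>Each translate of a column of \<open>Y\<close> is moved to the other side, where
    \<open>k\<close> stays in \<open>K\<close> by \<open>shift\<close>.\<close>
  have Uorth: "ip ?A (U j) k = 0" if k: "k \<in> K" for j k
  proof -
    have kl2: "k \<in> l2 ?A" using k by (simp add: K_def)
    have "ip ?A (U j) k = (\<Sum>m\<in>UNIV. \<Sum>h\<in>Poly_Mapping.keys (f $ m $ j).
        Poly_Mapping.lookup (f $ m $ j) h * ip ?A (\<lambda>(i, g). Y m (i, g \<otimes> inv h)) k)"
      unfolding U_eq using kl2 by (simp add: ip_sum ip_scale l2_sum tl2)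
    also have "\<dots> = 0"
      using orth[OF shift[OF k]]
      by (intro sum.neutral ballI) (simp add: ip_translate keys_carrier[OF f] Y_def[symmetric])
    finally show ?thesis .
  qed
  define E where "E j = (\<lambda>a. unit_col G j a - U j a)" for j
  have EK: "E j \<in> K" for j
    using l2_diff[OF unit_col_l2 Ul2]
    by (simp add: K_def E_def lact_diff lact_unit_col[OF f] U_def lact_ract[OF f _ Yinv])
  have El2: "E j \<in> l2 ?A" for j using EK by (simp add: K_def)
  \<comment> \<open>As \<open>U j\<close> is orthogonal to \<open>E j\<close>, the squared norm of
    \<open>E j\<close> is its inner product with the unit column, a single value of
    \<open>E j\<close>. Summed over \<open>j\<close>, this is n - tr(Y f).\<close>
  have "complex_of_real (sqnorm ?A (E j)) = 1 - U j (j, \<one>)" for j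
  proof -
    have "ip ?A (E j) (E j) = ip ?A (unit_col G j) (E j) - ip ?A (U j) (E j)"
      using ip_diff[OF unit_col_l2 Ul2 El2, of j j j] by (simp only: E_def)
    also have "\<dots> = cnj (E j (j, \<one>))"
      using Uorth[OF EK] ip_commute[of ?A "unit_col G j" "E j"] by (simp add: ip_unit_col)
    finally have "cnj (complex_of_real (sqnorm ?A (E j))) = E j (j, \<one>)"
      by (simp add: ip_self[OF El2])
    then show ?thesis
      by (simp add: E_def unit_col_def)
  qed
  then have "complex_of_real (\<Sum>j\<in>UNIV. sqnorm ?A (E j)) = (\<Sum>j\<in>UNIV. 1 - U j (j, \<one>))"
    by simp
  also have "\<dots> = 0"
    using trace_ract[OF f, of Y] by (simp add: sum_subtractf U_def Yinv unit_col_def)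
  finally have "(\<Sum>j\<in>UNIV. sqnorm ?A (E j)) = 0"
    by (simp only: of_real_eq_0_iff)
  then have "sqnorm ?A (E j) = 0" for j
    by (simp add: sum_nonneg_eq_0_iff sqnorm_nonneg)
  then have E0: "E j a = 0" if "a \<in> ?A" for j a
    using pointwise_le_sqnorm[OF El2 that, of j] by simp
  \<comment> \<open>Orthogonality to the unit columns only controls values at the identity of G;
    translating by \<open>g\<close> brings the value at \<open>g\<close> there.\<close>
  define w where "w = (\<lambda>(i, g'). v (i, g' \<otimes> g))"
  have wK: "w \<in> K" unfolding w_def using v ker g by (intro shift) (auto simp: K_def)
  have "v (i, g) = w (i, \<one>)" using g by (simp add: w_def)
  also have "\<dots> = ip ?A w (unit_col G i)" by (simp add: ip_unit_col)
  also have "\<dots> = ip ?A w (U i)"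
    unfolding ip_def using E0 by (intro infsum_cong) (simp add: E_def)
  also have "\<dots> = 0" using Uorth[OF wK] ip_commute by (metis complex_cnj_zero)
  finally show ?thesis .
qed

section \<open>Transfer to vectors and matrices over G\<close>

text \<open>The function is a finite sum of slices, each supported over one index. \<open>l2\<close>
  leaves values off the carrier free, whereas \<open>ell2\<close> makes them 0.\<close>

lemma l2_uncurry:
  fixes \<eta> :: "'n::finite \<Rightarrow> 'a \<Rightarrow> complex"
  assumes "\<And>k. \<eta> k \<in> ell2 G"
  shows "(\<lambda>(k, g). \<eta> k g) \<in> l2 (UNIV \<times> carrier G)"
proof -
  let ?A = "UNIV \<times> carrier G :: ('n \<times> 'a) set"
  have "(\<lambda>a. if fst a = k then \<eta> k (snd a) else 0) \<in> l2 ?A" for k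
  proof -
    have "bij_betw snd ({k} \<times> carrier G) (carrier G)"
      by (auto simp: bij_betw_def inj_on_def)
    from summable_on_reindex_bij_betw[OF this, of "\<lambda>g. (cmod (\<eta> k g))\<^sup>2"] assms[of k]
    have "(\<lambda>a. (cmod (\<eta> k (snd a)))\<^sup>2) summable_on {k} \<times> carrier G"
      by (simp add: ell2_def)
    then show ?thesis
      unfolding l2_def
      by (subst mem_Collect_eq, rule summable_on_cong_neutral[THEN iffD1, rotated -1])
         (auto split: if_splits)
  qed
  then have "(\<lambda>a. \<Sum>k\<in>UNIV. if fst a = k then \<eta> k (snd a) else 0) \<in> l2 ?A"
    by (rule l2_sum)
  then show ?thesis by (simp add: case_prod_unfold)
qed

lemma lam_vec_lact:
  assumes "f \<in> mats (group_ring G)" "g \<in> carrier G"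
  shows "(lam_vec G f \<eta> $ l) g = lact G f (\<lambda>(k, g). (\<eta> $ k) g) l g"
  using assms by (simp add: lam_vec_def lact_def conv_lookup_left mats_def)

lemma lam_mat_lact:
  assumes "f \<in> mats (group_ring G)" "g \<in> carrier G"
  shows "(lam_mat G f \<xi> $ i $ j) g = lact G f (\<lambda>(k, g). (\<xi> $ k $ j) g) i g"
  using assms by (simp add: lam_mat_def lact_def conv_lookup_left mats_def)

lemma mat_lam_ract:
  assumes "f \<in> mats (group_ring G)" "g \<in> carrier G"
  shows "(mat_lam G \<xi> f $ i $ j) g = ract G (\<lambda>k (i, g). (\<xi> $ i $ k) g) f j (i, g)"
  using assms by (simp add: mat_lam_def ract_def conv_lookup_right mats_def)

end

theorem proposition2p2:
  fixes G :: "('a, 'b) monoid_scheme" (structure)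
    and f :: "('a \<Rightarrow>\<^sub>0 complex) ^ 'n ^ 'n"
    and \<xi> :: "('a \<Rightarrow> complex) ^ 'n ^ 'n"
  assumes "group G"
    and "countable (carrier G)"
    and "f \<in> mats (group_ring G)"
    and "\<xi> \<in> mats (ell2 G)"
    and "lam_mat G f \<xi> = delta_id G"
  shows "inj_on (lam_vec G f) (vecs (ell2 G))
    \<and> inj_on (lam_mat G f) (mats (ell2 G))
    \<and> mat_lam G \<xi> f = delta_id G
    \<and> (f \<in> mats (group_ring_real G) \<longrightarrow> \<xi> \<in> mats (ell2_real G))"
proof -
  interpret group G by fact
  note f = \<open>f \<in> mats (group_ring G)\<close> and \<xi> = \<open>\<xi> \<in> mats (ell2 G)\<close>
  let ?X = "\<lambda>j (i, g). (\<xi> $ i $ j) g"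
  have X: "?X j \<in> l2 (UNIV \<times> carrier G)" for j
    using \<xi> by (intro l2_uncurry) (simp add: mats_def)
  have right_inv: "lact G f (?X j) i g = unit_col G j (i, g)" if "g \<in> carrier G" for i j g
    using lam_mat_lact[OF f that, of \<xi> i j] \<open>lam_mat G f \<xi> = delta_id G\<close>
    by (auto simp: delta_id_def unit_col_def indicator_def split: if_splits)
  have off: "x g = 0" if "x \<in> ell2 G" "g \<notin> carrier G" for x g
    using that by (simp add: ell2_def)
  have inj: "v (i, g) = w (i, g)"
    if "v \<in> l2 (UNIV \<times> carrier G)" "w \<in> l2 (UNIV \<times> carrier G)" "g \<in> carrier G"
      and "\<And>i g. g \<in> carrier G \<Longrightarrow> lact G f v i g = lact G f w i g" for v w i g
    using right_invertible_imp_trivial_kernel[OF f X right_inv l2_diff[OF that(1,2)], of g i] that(3,4)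
    by (simp add: lact_diff)
  have inj_vec: "inj_on (lam_vec G f) (vecs (ell2 G))"
  proof (rule inj_onI)
    fix x y assume xy: "x \<in> vecs (ell2 G)" "y \<in> vecs (ell2 G)" and eq: "lam_vec G f x = lam_vec G f y"
    have l2: "(\<lambda>(k, g). (x $ k) g) \<in> l2 (UNIV \<times> carrier G)" "(\<lambda>(k, g). (y $ k) g) \<in> l2 (UNIV \<times> carrier G)"
      using xy by (auto intro!: l2_uncurry simp: vecs_def)
    have "(x $ i) g = (y $ i) g" if "g \<in> carrier G" for i g
      using inj[OF l2 that, of i] eq by (simp add: lam_vec_lact[OF f, symmetric])
    moreover have "(x $ i) g = (y $ i) g" if "g \<notin> carrier G" for i g
      using xy that by (simp add: vecs_def off)
    ultimately show "x = y"
      by (simp add: vec_eq_iff fun_eq_iff) blast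
  qed
  have inj_mat: "inj_on (lam_mat G f) (mats (ell2 G))"
  proof (rule inj_onI)
    fix x y assume xy: "x \<in> mats (ell2 G)" "y \<in> mats (ell2 G)" and eq: "lam_mat G f x = lam_mat G f y"
    have l2: "(\<lambda>(k, g). (x $ k $ j) g) \<in> l2 (UNIV \<times> carrier G)"
      "(\<lambda>(k, g). (y $ k $ j) g) \<in> l2 (UNIV \<times> carrier G)" for j
      using xy by (auto intro!: l2_uncurry simp: mats_def)
    have "(x $ i $ j) g = (y $ i $ j) g" if "g \<in> carrier G" for i j g
      using inj[OF l2[of j] that, of i] eq by (simp add: lam_mat_lact[OF f, symmetric])
    moreover have "(x $ i $ j) g = (y $ i $ j) g" if "g \<notin> carrier G" for i j g
      using xy that by (simp add: mats_def off)
    ultimately show "x = y"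
      by (simp add: vec_eq_iff fun_eq_iff) blast
  qed
  have "mat_lam G \<xi> f = delta_id G"
  proof -
    have m: "mat_lam G \<xi> f \<in> mats (ell2 G)" by (rule mat_lam_ell2[OF f \<xi>])
    \<comment> \<open>Square-summability of \<xi> f comes from \<open>mat_lam_ell2\<close>,
      transported along agreement on the carrier.\<close>
    have l2: "ract G ?X f j \<in> l2 (UNIV \<times> carrier G)" for j
    proof -
      have "(\<lambda>(i, g). (mat_lam G \<xi> f $ i $ j) g) \<in> l2 (UNIV \<times> carrier G)"
        using m by (intro l2_uncurry) (simp add: mats_def)
      then show ?thesis
        unfolding l2_def mem_Collect_eq
        by (rule summable_on_cong[THEN iffD1, rotated]) (auto simp: mat_lam_ract[OF f])
    qed
    have "ract G ?X f j (i, g) = unit_col G j (i, g)" if "g \<in> carrier G" for i j g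
      using l2 unit_col_l2 that
      by (rule inj) (simp add: lact_unit_col[OF f] lact_ract[OF f _ right_inv])
    then have "(mat_lam G \<xi> f $ i $ j) g = (delta_id G $ i $ j) g" if "g \<in> carrier G" for i j g
      using that by (simp add: mat_lam_ract[OF f] delta_id_def unit_col_def)
    moreover have "(mat_lam G \<xi> f $ i $ j) g = (delta_id G $ i $ j) g" if "g \<notin> carrier G" for i j g
      using m that by (auto simp: mats_def off delta_id_def indicator_def)
    ultimately show ?thesis
      by (simp add: vec_eq_iff fun_eq_iff) blast
  qed
  \<comment> \<open>Real coefficients of f are essential here:
    \<open>complex_right_inverse_not_real\<close> gives a complex f with a right inverse that is not
    real.\<close>
  moreover have "\<xi> \<in> mats (ell2_real G)" if "f \<in> mats (group_ring_real G)"
  proof -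
    have real: "cnj (Poly_Mapping.lookup (f $ i $ j) h) = Poly_Mapping.lookup (f $ i $ j) h" for i j h
      using that by (simp add: mats_def group_ring_real_def Reals_cnj_iff)
    have conj: "lact G f (\<lambda>a. cnj (v a)) i g = cnj (lact G f v i g)" for v i g
      by (simp add: lact_def real)
    \<comment> \<open>Conjugation commutes with a real f and fixes the unit columns, so both sides
      have the same image under f.\<close>
    have "cnj (?X j (i, g)) = ?X j (i, g)" if "g \<in> carrier G" for i j g
      using _ X that
    proof (rule inj)
      show "(\<lambda>a. cnj (?X j a)) \<in> l2 (UNIV \<times> carrier G)" using X[of j] by (simp add: l2_def)
    qed (simp add: conj right_inv unit_col_def)
    with \<xi> show ?thesis
      by (simp add: mats_def ell2_real_def Reals_cnj_iff)
  qed
  ultimately show ?thesis using inj_vec inj_mat by blast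
qed

end
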